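(* Let $R$ be a ring. Then the following are equivalent: (i) $R$ is either local with $J(R)$ nil, or $R$ is UNC; (ii) $R$ is a GUNC ring.
   Context: Rings are associative with identity, not necessarily commutative. $J(R)$ denotes the Jacobson radical. $R$ is local if $R/J(R)$ is a division ring. An element $a\in R$ is uniquely nil-clean (UNC) if there is a unique idempotent $e\in R$ such that $a-e$ is nilpotent (commutation of $a$ and $e$ is not required). The ring $R$ is UNC if every element of $R$ is uniquely nil-clean. The ring $R$ is generalized uniquely nil-clean (GUNC) if every non-invertible element of $R$ is uniquely nil-clean. *)

theory Defs
  imports "HOL-Algebra.QuotRing"
begin

locale left_ideal = additive_subgroup I R + ring R for I and R (structure) +
  assumes I_l_closed: "\<lbrakk>a \<in> I; x \<in> carrier R\<rbrakk> \<Longrightarrow> x \<otimes> a \<in> I"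

locale maximal_left_ideal = left_ideal +
  assumes I_notcarr: "carrier R \<noteq> I"
    and I_maximal: "\<lbrakk>left_ideal J R; I \<subseteq> J; J \<subseteq> carrier R\<rbrakk> \<Longrightarrow> J = I \<or> J = carrier R"

text \<open>The intersection of all maximal left ideals, taken inside the carrier, so that the zero
  ring (which has no maximal left ideal) is its own Jacobson radical.\<close>

definition jacobson_radical :: "('a, 'b) ring_scheme \<Rightarrow> 'a set" where
  "jacobson_radical R = {x \<in> carrier R. \<forall>M. maximal_left_ideal M R \<longrightarrow> x \<in> M}"

text \<open>Division rings in the sense of \<open>HOL-Algebra\<close>, i.e. the locale \<open>field\<close> without
  commutativity; the name \<open>division_ring\<close> is already that of a type class.\<close>

locale skew_field = ring +
  assumes one_not_zero: "\<one> \<noteq> \<zero>"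
    and skew_field_Units: "Units R = carrier R - {\<zero>}"

definition local_ring :: "('a, 'b) ring_scheme \<Rightarrow> bool" where
  "local_ring R \<longleftrightarrow> ring R \<and> skew_field (R Quot jacobson_radical R)"

definition idempotent_elem :: "('a, 'b) ring_scheme \<Rightarrow> 'a \<Rightarrow> bool" where
  "idempotent_elem R e \<longleftrightarrow> e \<in> carrier R \<and> e \<otimes>\<^bsub>R\<^esub> e = e"

definition nilpotent_elem :: "('a, 'b) ring_scheme \<Rightarrow> 'a \<Rightarrow> bool" where
  "nilpotent_elem R a \<longleftrightarrow> a \<in> carrier R \<and> (\<exists>n::nat. n > 0 \<and> a [^]\<^bsub>R\<^esub> n = \<zero>\<^bsub>R\<^esub>)"

definition nil_subset :: "('a, 'b) ring_scheme \<Rightarrow> 'a set \<Rightarrow> bool" where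
  "nil_subset R I \<longleftrightarrow> (\<forall>a\<in>I. nilpotent_elem R a)"

definition uniquely_nil_clean :: "('a, 'b) ring_scheme \<Rightarrow> 'a \<Rightarrow> bool" where
  "uniquely_nil_clean R a \<longleftrightarrow>
     a \<in> carrier R \<and> (\<exists>!e. idempotent_elem R e \<and> nilpotent_elem R (a \<ominus>\<^bsub>R\<^esub> e))"

definition UNC_ring :: "('a, 'b) ring_scheme \<Rightarrow> bool" where
  "UNC_ring R \<longleftrightarrow> ring R \<and> (\<forall>a\<in>carrier R. uniquely_nil_clean R a)"

definition GUNC_ring :: "('a, 'b) ring_scheme \<Rightarrow> bool" where
  "GUNC_ring R \<longleftrightarrow> ring R \<and> (\<forall>a\<in>carrier R - Units R. uniquely_nil_clean R a)"

end

theory Submission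
  imports Defs
begin

text \<open>In a GUNC ring every nontrivial idempotent \<open>e\<close> is a non-unit, and comparing the nil-clean
  decompositions of \<open>e\<close> with idempotent parts \<open>e\<close>, \<open>e + er(1-e)\<close> and \<open>e + (1-e)re\<close> shows that
  \<open>e\<close> is central. If some nontrivial idempotent exists, every \<open>a\<close> splits into the non-units \<open>ae\<close>
  and \<open>a(1-e)\<close>, and their unique decompositions glue to one of \<open>a\<close>, so the ring is UNC. Otherwise
  every non-unit is nilpotent; then the nilpotent elements form an ideal, which is the only
  maximal left ideal, so the ring is local with nil radical.\<close>

context ring
begin

section \<open>Units and nilpotent elements\<close>

text \<open>A right inverse \<open>y (x y)^-1\<close> and a left inverse \<open>(y x)^-1 y\<close>
  of the same element must coincide.\<close>

lemma Units_if_prods_Units: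
  assumes "x \<in> carrier R" "y \<in> carrier R" "x \<otimes> y \<in> Units R" "y \<otimes> x \<in> Units R"
  shows "x \<in> Units R"
proof -
  let ?r = "y \<otimes> inv (x \<otimes> y)" and ?l = "inv (y \<otimes> x) \<otimes> y"
  have r: "x \<otimes> ?r = \<one>" and l: "?l \<otimes> x = \<one>"
    using assms by (simp_all add: m_assoc[symmetric]) (simp_all add: m_assoc)
  have "?l = ?r"
    by (rule inv_unique[OF l r]) (use assms in auto)
  with l have "?r \<otimes> x = \<one>"
    by simp
  moreover have "?r \<in> carrier R"
    using assms by simp
  ultimately show ?thesis
    unfolding Units_def using r assms(1) by blast
qed

lemma nilpotent_pow_zero_mono:
  assumes "a \<in> carrier R" "a [^] (n::nat) = \<zero>" "n \<le> m"
  shows "a [^] m = \<zero>"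
  using assms nat_pow_mult[of a n "m - n"] by simp

text \<open>Repeated squaring replaces the geometric series: \<open>1 - x\<close> and
  \<open>1 + x\<close> commute with product \<open>1 - x^2\<close>, so \<open>1 - x\<close> is a
  unit once \<open>1 - x^2\<close> is. Hence the induction on \<open>k\<close> for exponents
  \<open>2^k\<close>; any exponent \<open>n\<close> is covered because
  \<open>n < 2^n\<close>.\<close>

lemma one_minus_nilpotent_Units:
  assumes "nilpotent_elem R a"
  shows "\<one> \<ominus> a \<in> Units R"
proof -
  have pow2: "\<one> \<ominus> x \<in> Units R" if "x \<in> carrier R" "x [^] ((2::nat) ^ k) = \<zero>" for x k
    using that
  proof (induction k arbitrary: x)
    case 0
    then show ?case by (simp add: minus_eq)
  next
    case (Suc k)
    have "(x \<otimes> x) [^] ((2::nat) ^ k) = \<zero>"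
      using Suc.prems nat_pow_pow[of x 2 "2 ^ k"] by (simp add: numeral_2_eq_2)
    then have "\<one> \<ominus> x \<otimes> x \<in> Units R"
      using Suc by simp
    moreover have "(\<one> \<ominus> x) \<otimes> (\<one> \<oplus> x) = \<one> \<ominus> x \<otimes> x" "(\<one> \<oplus> x) \<otimes> (\<one> \<ominus> x) = \<one> \<ominus> x \<otimes> x"
      using Suc.prems(1) by (simp_all add: l_distr r_distr minus_eq l_minus r_minus minus_add a_assoc r_neg1 r_neg2)
    ultimately show ?case
      using Units_if_prods_Units[of "\<one> \<ominus> x" "\<one> \<oplus> x"] Suc.prems(1) by simp
  qed
  obtain n :: nat where "a \<in> carrier R" "a [^] n = \<zero>"
    using assms by (auto simp: nilpotent_elem_def)
  then show ?thesis
    using pow2[of a n] nilpotent_pow_zero_mono[of a n "2 ^ n"] less_exp[of n] by simp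
qed

lemma nilpotent_elem_uminus:
  assumes "nilpotent_elem R a"
  shows "nilpotent_elem R (\<ominus> a)"
proof -
  obtain n :: nat where a: "a \<in> carrier R" and n: "n > 0" "a [^] n = \<zero>"
    using assms by (auto simp: nilpotent_elem_def)
  have "(\<ominus> a) [^] k = a [^] k \<or> (\<ominus> a) [^] k = \<ominus> (a [^] k)" for k :: nat
    by (induction k) (use a in \<open>auto simp: l_minus r_minus\<close>)
  from this[of n] n a show ?thesis
    unfolding nilpotent_elem_def by auto
qed

lemma Units_if_minus_one_nilpotent:
  assumes "a \<in> carrier R" "nilpotent_elem R (a \<ominus> \<one>)"
  shows "a \<in> Units R"
proof -
  have "\<one> \<ominus> \<ominus> (a \<ominus> \<one>) = a"
    using assms(1) by algebra
  with one_minus_nilpotent_Units[OF nilpotent_elem_uminus[OF assms(2)]] show ?thesis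
    by simp
qed

lemma nilpotent_elem_zero: "nilpotent_elem R \<zero>"
  unfolding nilpotent_elem_def by (auto intro!: exI[of _ "1::nat"])

section \<open>Idempotents that are units or nilpotent\<close>

lemma idempotent_Units_eq_one:
  assumes "idempotent_elem R e" "e \<in> Units R"
  shows "e = \<one>"
  using assms unfolding idempotent_elem_def by (metis Units_l_cancel one_closed r_one)

lemma idempotent_pow:
  assumes "idempotent_elem R e" "(n::nat) > 0"
  shows "e [^] n = e"
  using assms(2)
proof (induction n)
  case (Suc n)
  then show ?case
    using assms(1) by (cases n) (auto simp: idempotent_elem_def)
qed simp

lemma idempotent_nilpotent_eq_zero:
  assumes "idempotent_elem R e" "nilpotent_elem R e"
  shows "e = \<zero>"
  using assms idempotent_pow unfolding nilpotent_elem_def by metis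

section \<open>Local rings with nil radical are GUNC\<close>

text \<open>An element outside the radical J is invertible modulo J, say with inverse
  \<open>b\<close>. Then \<open>a b\<close> and \<open>b a\<close> lie in J + 1, which consists of
  units because J is nil, so \<open>a\<close> is itself a unit. Cosets are treated as plain sets:
  zero in J puts every representative into its own coset.\<close>

lemma local_ring_nonunit_in_radical:
  assumes loc: "local_ring R" and nil: "nil_subset R (jacobson_radical R)"
    and a: "a \<in> carrier R" "a \<notin> Units R"
  shows "a \<in> jacobson_radical R"
proof (rule ccontr)
  assume aJ: "a \<notin> jacobson_radical R"
  let ?J = "jacobson_radical R"
  interpret Q: skew_field "R Quot ?J"
    using loc by (simp add: local_ring_def)
  have zJ: "\<zero> \<in> ?J"
    unfolding jacobson_radical_def maximal_left_ideal_def left_ideal_def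
    by (auto intro: additive_subgroup.zero_closed)
  have self: "x \<in> ?J +> x" if "x \<in> carrier R" for x
    using zJ that by (force simp: a_r_coset_def')
  \<comment> \<open>This coset contains \<open>a\<close>, whereas the zero of the quotient is J
    itself.\<close>
  have "?J +> a \<in> carrier (R Quot ?J) - {\<zero>\<^bsub>R Quot ?J\<^esub>}"
    using a(1) aJ self[of a] by (auto simp: FactRing_def A_RCOSETS_def')
  then have "?J +> a \<in> Units (R Quot ?J)"
    by (simp add: Q.skew_field_Units)
  then obtain B where "B \<in> carrier (R Quot ?J)"
    and B: "(?J +> a) \<otimes>\<^bsub>R Quot ?J\<^esub> B = \<one>\<^bsub>R Quot ?J\<^esub>" "B \<otimes>\<^bsub>R Quot ?J\<^esub> (?J +> a) = \<one>\<^bsub>R Quot ?J\<^esub>"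
    unfolding Units_def by auto
  then obtain b where b: "b \<in> carrier R" "B = ?J +> b"
    by (auto simp: FactRing_def A_RCOSETS_def')
  have prods: "x \<otimes> y \<in> (?J +> x) \<otimes>\<^bsub>R Quot ?J\<^esub> (?J +> y)" if "x \<in> carrier R" "y \<in> carrier R" for x y
    using that self by (auto simp: FactRing_def rcoset_mult_def intro!: bexI)
  have unit: "x \<in> Units R" if "x \<in> ?J +> \<one>" for x
  proof -
    obtain j where j: "j \<in> ?J" "x = j \<oplus> \<one>"
      using \<open>x \<in> ?J +> \<one>\<close> by (auto simp: a_r_coset_def')
    then have nj: "nilpotent_elem R j"
      using nil by (simp add: nil_subset_def)
    then have "j \<in> carrier R"
      by (simp add: nilpotent_elem_def)
    then have "x \<ominus> \<one> = j" "x \<in> carrier R"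
      using j(2) by (simp_all, algebra)
    with nj show ?thesis
      using Units_if_minus_one_nilpotent by simp
  qed
  \<comment> \<open>Each product of representatives lies in the product of their cosets, which is
    the coset of one.\<close>
  have "a \<otimes> b \<in> ?J +> \<one>" "b \<otimes> a \<in> ?J +> \<one>"
    using prods[of a b] prods[of b a] a b B by (simp_all add: FactRing_def)
  then show False
    using Units_if_prods_Units[of a b] unit a b by blast
qed

text \<open>Every nonunit is nilpotent, so zero serves as its idempotent part. A competing
  idempotent that is a unit equals one and would make \<open>a\<close> a unit; one that is a nonunit
  is nilpotent, hence zero.\<close>

lemma local_nil_radical_imp_GUNC:
  assumes loc: "local_ring R" and nil: "nil_subset R (jacobson_radical R)"
  shows "GUNC_ring R"
proof -
  have nilp: "nilpotent_elem R a" if "a \<in> carrier R" "a \<notin> Units R" for a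
    using local_ring_nonunit_in_radical[OF assms that] nil by (simp add: nil_subset_def)
  have "uniquely_nil_clean R a" if a: "a \<in> carrier R" "a \<notin> Units R" for a
    unfolding uniquely_nil_clean_def
  proof (intro conjI ex1I[of _ \<zero>])
    show "idempotent_elem R \<zero>" "nilpotent_elem R (a \<ominus> \<zero>)"
      using nilp[OF a] a by (simp_all add: idempotent_elem_def minus_eq)
    fix e assume e: "idempotent_elem R e \<and> nilpotent_elem R (a \<ominus> e)"
    then have "e \<notin> Units R"
      using Units_if_minus_one_nilpotent idempotent_Units_eq_one a by blast
    then show "e = \<zero>"
      using e nilp idempotent_nilpotent_eq_zero by (auto simp: idempotent_elem_def)
  qed fact
  then show ?thesis
    unfolding GUNC_ring_def using ring_axioms by blast
qed

section \<open>Rings whose nonunits are nilpotent are local\<close>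

text \<open>If \<open>x a\<close> were a unit, \<open>a\<close> would have a left inverse
  \<open>y\<close>, and cancelling from the middle gives \<open>y^k a^k = 1\<close> for all
  \<open>k\<close>, which is absurd once \<open>a^k = 0\<close>. The other side is symmetric;
  \<open>a\<close> and \<open>x\<close> need not commute.\<close>

lemma nilpotent_prod_not_Units:
  assumes ne: "\<one> \<noteq> \<zero>" and a: "nilpotent_elem R a" and x: "x \<in> carrier R"
  shows "x \<otimes> a \<notin> Units R" "a \<otimes> x \<notin> Units R"
proof -
  obtain n :: nat where ac: "a \<in> carrier R" and n: "a [^] n = \<zero>"
    using a by (auto simp: nilpotent_elem_def)
  show "x \<otimes> a \<notin> Units R"
  proof
    assume u: "x \<otimes> a \<in> Units R"
    define y where "y = inv (x \<otimes> a) \<otimes> x"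
    have y: "y \<in> carrier R" "y \<otimes> a = \<one>"
      using u x ac by (simp_all add: y_def m_assoc)
    have "y [^] k \<otimes> a [^] k = \<one>" for k :: nat
    proof (induction k)
      case (Suc k)
      have "y [^] Suc k \<otimes> a [^] Suc k = y [^] k \<otimes> ((y \<otimes> a) \<otimes> a [^] k)"
        using y(1) ac nat_pow_Suc2[of a k] by (simp add: m_assoc)
      then show ?case
        using y ac Suc by simp
    qed simp
    from this[of n] n y ne show False by simp
  qed
  show "a \<otimes> x \<notin> Units R"
  proof
    assume u: "a \<otimes> x \<in> Units R"
    define y where "y = x \<otimes> inv (a \<otimes> x)"
    have y: "y \<in> carrier R" "a \<otimes> y = \<one>"
      using u x ac by (simp_all add: y_def m_assoc[symmetric])
    have "a [^] k \<otimes> y [^] k = \<one>" for k :: nat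
    proof (induction k)
      case (Suc k)
      have "a [^] Suc k \<otimes> y [^] Suc k = a [^] k \<otimes> ((a \<otimes> y) \<otimes> y [^] k)"
        using y(1) ac nat_pow_Suc2[of y k] by (simp add: m_assoc)
      then show ?case
        using y ac Suc by simp
    qed simp
    from this[of n] n y ne show False by simp
  qed
qed

lemma left_ideal_no_Units:
  assumes "left_ideal M R" "M \<noteq> carrier R"
  shows "M \<inter> Units R = {}"
proof -
  interpret M: left_ideal M R by fact
  { fix u assume u: "u \<in> M" "u \<in> Units R"
    then have one: "\<one> \<in> M"
      using M.I_l_closed[of u "inv u"] by simp
    have "x \<in> M" if "x \<in> carrier R" for x
      using M.I_l_closed[OF one that] that by simp
    then have "M = carrier R"
      using M.a_subset by blast }
  with assms(2) show ?thesis by blast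
qed

text \<open>The nilpotent elements are exactly the nonunits. They form an ideal \<open>N\<close>,
  and a proper left ideal contains no unit, so it lies in \<open>N\<close>. Hence \<open>N\<close>
  is the only maximal left ideal and equals the radical, and modulo \<open>N\<close> every nonzero
  coset is represented by a unit.\<close>

lemma local_if_nonunits_nilpotent:
  assumes ne: "\<one> \<noteq> \<zero>" and nilp: "\<And>a. a \<in> carrier R - Units R \<Longrightarrow> nilpotent_elem R a"
  shows "local_ring R \<and> nil_subset R (jacobson_radical R)"
proof -
  define N where "N = {a. nilpotent_elem R a}"
  have Nc: "N \<subseteq> carrier R"
    by (auto simp: N_def nilpotent_elem_def)
  have Nunit: "a \<notin> Units R" if "a \<in> N" for a
    using nilpotent_prod_not_Units(1)[OF ne, of a \<one>] that Nc by (auto simp: N_def)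
  have mem: "a \<in> N \<longleftrightarrow> a \<in> carrier R \<and> a \<notin> Units R" for a
    using Nunit Nc nilp by (auto simp: N_def)
  have absorb: "x \<otimes> a \<in> N" "a \<otimes> x \<in> N" if "a \<in> N" "x \<in> carrier R" for a x
    using nilpotent_prod_not_Units[OF ne, of a x] that Nc mem by (auto simp: N_def)
  have sum: "a \<oplus> b \<in> N" if ab: "a \<in> N" "b \<in> N" for a b
  proof (rule ccontr)
    have c: "a \<in> carrier R" "b \<in> carrier R"
      using ab Nc by auto
    assume "a \<oplus> b \<notin> N"
    then have u: "a \<oplus> b \<in> Units R"
      using mem c by simp
    define v where "v = inv (a \<oplus> b)"
    have v: "v \<in> carrier R"
      using u by (simp add: v_def)
    have "v \<otimes> a \<oplus> v \<otimes> b = \<one>"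
      using u c by (simp add: v_def r_distr[symmetric])
    \<comment> \<open>If \<open>a + b\<close> is a unit, then \<open>v b = 1 - v a\<close> with
      \<open>v a\<close> nilpotent, so \<open>v b\<close> would be both a unit and a member of
      \<open>N\<close>.\<close>
    moreover have "v \<otimes> b = (v \<otimes> a \<oplus> v \<otimes> b) \<ominus> v \<otimes> a"
      using c v by algebra
    ultimately have "v \<otimes> b = \<one> \<ominus> v \<otimes> a"
      by simp
    moreover have "\<one> \<ominus> v \<otimes> a \<in> Units R"
      using one_minus_nilpotent_Units absorb(1)[OF ab(1) v] by (simp add: N_def)
    ultimately show False
      using absorb(1)[OF ab(2) v] mem by simp
  qed
  have idN: "ideal N R"
  proof (intro idealI)
    show "subgroup N (add_monoid R)"
      using Nc sum nilpotent_elem_zero nilpotent_elem_uminus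
      by (auto intro!: add.subgroupI simp: N_def a_inv_def[symmetric])
  qed (use absorb ring_axioms in auto)
  interpret N: ideal N R by fact
  have leftN: "left_ideal N R"
    by (intro left_ideal.intro left_ideal_axioms.intro)
       (use absorb N.additive_subgroup_axioms ring_axioms in auto)
  have oneN: "\<one> \<notin> N"
    using Nunit by auto
  have maxN: "maximal_left_ideal N R"
  proof (intro maximal_left_ideal.intro maximal_left_ideal_axioms.intro)
    show "carrier R \<noteq> N"
      using oneN by auto
    fix L assume L: "left_ideal L R" "N \<subseteq> L" "L \<subseteq> carrier R"
    show "L = N \<or> L = carrier R"
      using left_ideal_no_Units[OF L(1)] L mem by blast
  qed fact
  have only: "M = N" if "maximal_left_ideal M R" for M
  proof -
    interpret M: maximal_left_ideal M R by fact
    have "M \<subseteq> N"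
      \<comment> \<open>A proper left ideal avoids the units, and all other elements belong to
        \<open>N\<close>.\<close>
      using left_ideal_no_Units[OF M.left_ideal_axioms] M.I_notcarr M.a_subset mem by blast
    then show ?thesis
      using M.I_maximal[OF leftN _ Nc] N.a_subset oneN by blast
  qed
  have J: "jacobson_radical R = N"
    unfolding jacobson_radical_def using maxN only Nc by blast
  interpret Q: ring "R Quot N"
    by (rule N.quotient_is_ring)
  have coset_mult: "(N +> x) \<otimes>\<^bsub>R Quot N\<^esub> (N +> y) = N +> (x \<otimes> y)"
    if "x \<in> carrier R" "y \<in> carrier R" for x y
    using N.rcoset_mult_add[OF that] by (simp add: FactRing_def)
  have coset_in: "N +> x \<in> carrier (R Quot N)" if "x \<in> carrier R" for x
    using that by (auto simp: FactRing_def A_RCOSETS_def')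
  have Qne: "\<one>\<^bsub>R Quot N\<^esub> \<noteq> \<zero>\<^bsub>R Quot N\<^esub>"
    using oneN N.a_rcos_self[of \<one>] by (auto simp: FactRing_def)
  have "skew_field (R Quot N)"
  proof (intro skew_field.intro skew_field_axioms.intro Qne N.quotient_is_ring)
    show "Units (R Quot N) = carrier (R Quot N) - {\<zero>\<^bsub>R Quot N\<^esub>}"
    proof (intro equalityI subsetI)
      fix X assume X: "X \<in> Units (R Quot N)"
      moreover have "\<zero>\<^bsub>R Quot N\<^esub> \<notin> Units (R Quot N)"
        using Qne Q.Units_r_inv_ex[of "\<zero>\<^bsub>R Quot N\<^esub>"] by auto
      ultimately show "X \<in> carrier (R Quot N) - {\<zero>\<^bsub>R Quot N\<^esub>}"
        by auto
    next
      fix X assume X: "X \<in> carrier (R Quot N) - {\<zero>\<^bsub>R Quot N\<^esub>}"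
      then obtain x where x: "x \<in> carrier R" "X = N +> x"
        by (auto simp: FactRing_def A_RCOSETS_def')
      have "x \<notin> N"
        using X x N.a_rcos_const by (auto simp: FactRing_def)
      then have u: "x \<in> Units R"
        using x mem by simp
      have "(N +> x) \<otimes>\<^bsub>R Quot N\<^esub> (N +> inv x) = \<one>\<^bsub>R Quot N\<^esub>"
        "(N +> inv x) \<otimes>\<^bsub>R Quot N\<^esub> (N +> x) = \<one>\<^bsub>R Quot N\<^esub>"
        using u x coset_mult by (simp_all add: FactRing_def)
      then show "X \<in> Units (R Quot N)"
        using coset_in[of x] coset_in[of "inv x"] u x
        unfolding Units_def[of "R Quot N"] by blast
    qed
  qed
  then show ?thesis
    unfolding local_ring_def nil_subset_def J using ring_axioms by (simp add: N_def)
qed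

section \<open>Centrality of uniquely nil-clean idempotents\<close>

lemma uniquely_nil_clean_unique:
  assumes "uniquely_nil_clean R a" "idempotent_elem R e" "nilpotent_elem R (a \<ominus> e)"
    "idempotent_elem R f" "nilpotent_elem R (a \<ominus> f)"
  shows "e = f"
  using assms unfolding uniquely_nil_clean_def by blast

text \<open>Under these equations \<open>e + c\<close> is again idempotent, and
  \<open>e - (e + c) = -c\<close> squares to zero. So \<open>e\<close> and \<open>e + c\<close> are
  both idempotent parts of \<open>e\<close>, and uniqueness identifies them.\<close>

lemma uniquely_nil_clean_perturb:
  assumes e: "idempotent_elem R e" "uniquely_nil_clean R e" and c: "c \<in> carrier R"
    and sq: "c \<otimes> c = \<zero>" and split: "e \<otimes> c \<oplus> c \<otimes> e = c"
  shows "c = \<zero>"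
proof -
  have ec: "e \<in> carrier R" "e \<otimes> e = e"
    using e(1) by (auto simp: idempotent_elem_def)
  have "(e \<oplus> c) \<otimes> (e \<oplus> c) = e \<otimes> e \<oplus> (e \<otimes> c \<oplus> c \<otimes> e) \<oplus> c \<otimes> c"
    using ec(1) c by algebra
  then have f: "idempotent_elem R (e \<oplus> c)"
    using ec c sq split by (simp add: idempotent_elem_def)
  have diff: "e \<ominus> (e \<oplus> c) = \<ominus> c"
    using ec(1) c by algebra
  have "nilpotent_elem R c"
    using c sq unfolding nilpotent_elem_def by (auto intro!: exI[of _ "2::nat"] simp: numeral_2_eq_2)
  then have "nilpotent_elem R (e \<ominus> (e \<oplus> c))"
    using diff nilpotent_elem_uminus by simp
  moreover have "nilpotent_elem R (e \<ominus> e)"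
    using ec nilpotent_elem_zero by (simp add: minus_eq r_neg)
  ultimately have "e = e \<oplus> c"
    using uniquely_nil_clean_unique[OF e(2) e(1) _ f] by simp
  then show ?thesis
    using add.l_cancel_one' ec c by simp
qed

lemma uniquely_nil_clean_idempotent_central:
  assumes e: "idempotent_elem R e" "uniquely_nil_clean R e" and r: "r \<in> carrier R"
  shows "e \<otimes> r = r \<otimes> e"
proof -
  have ec: "e \<in> carrier R" "e \<otimes> e = e"
    using e(1) by (auto simp: idempotent_elem_def)
  have eel: "e \<otimes> (e \<otimes> x) = e \<otimes> x" if "x \<in> carrier R" for x
    using ec that by (simp add: m_assoc[symmetric])
  note simps = ec eel r m_assoc l_distr r_distr minus_eq l_minus r_minus r_neg l_neg
  \<comment> \<open>These are the off-diagonal Peirce corners \<open>e r (1 - e)\<close> and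
    \<open>(1 - e) r e\<close>. Each squares to zero and is fixed by \<open>e\<close> on one side
    and killed on the other. Once both vanish, \<open>e r = e r e = r e\<close>.\<close>
  let ?c = "e \<otimes> r \<ominus> e \<otimes> r \<otimes> e" and ?d = "r \<otimes> e \<ominus> e \<otimes> r \<otimes> e"
  have "?c = \<zero>"
    by (rule uniquely_nil_clean_perturb[OF e]) (simp_all add: simps)
  moreover have "?d = \<zero>"
    by (rule uniquely_nil_clean_perturb[OF e]) (simp_all add: simps)
  moreover have "e \<otimes> r = ?c \<oplus> e \<otimes> r \<otimes> e" "r \<otimes> e = ?d \<oplus> e \<otimes> r \<otimes> e"
    using ec r by (simp_all add: minus_eq a_assoc l_neg)
  ultimately show ?thesis
    by metis
qed

section \<open>Cutting and gluing along central idempotents\<close>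

lemma nilpotent_mult_central_idempotent:
  assumes "nilpotent_elem R x" "idempotent_elem R g"
    and "\<And>r. r \<in> carrier R \<Longrightarrow> g \<otimes> r = r \<otimes> g"
  shows "nilpotent_elem R (x \<otimes> g)"
proof -
  obtain n :: nat where x: "x \<in> carrier R" and n: "n > 0" "x [^] n = \<zero>"
    using assms by (auto simp: nilpotent_elem_def)
  have "(x \<otimes> g) [^] n = x [^] n \<otimes> g [^] n"
    using assms(2) assms(3)[OF x] x pow_mult_distrib[of x g n] by (simp add: idempotent_elem_def)
  then show ?thesis
    using x n assms(2) unfolding nilpotent_elem_def idempotent_elem_def by auto
qed

lemma idempotent_mult_central_idempotent:
  assumes "idempotent_elem R x" "idempotent_elem R g"
    and "\<And>r. r \<in> carrier R \<Longrightarrow> g \<otimes> r = r \<otimes> g"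
  shows "idempotent_elem R (x \<otimes> g)"
proof -
  have c: "x \<in> carrier R" "g \<in> carrier R" "x \<otimes> x = x" "g \<otimes> g = g"
    using assms by (auto simp: idempotent_elem_def)
  then have "(x \<otimes> g) \<otimes> (x \<otimes> g) = x \<otimes> (g \<otimes> x) \<otimes> g"
    by (simp add: m_assoc)
  also have "\<dots> = x \<otimes> (x \<otimes> g) \<otimes> g"
    using c assms(3)[of x] by simp
  also have "\<dots> = (x \<otimes> x) \<otimes> (g \<otimes> g)"
    using c(1,2) by (simp add: m_assoc)
  finally show ?thesis
    using c by (simp add: idempotent_elem_def)
qed

text \<open>The Peirce decomposition at a central idempotent \<open>e\<close>, with \<open>f\<close> in the role of \<open>1 - e\<close>.\<close>

context
  fixes e f
  assumes e: "idempotent_elem R e" and f: "idempotent_elem R f" and sum: "e \<oplus> f = \<one>"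
    and ecent: "\<And>r. r \<in> carrier R \<Longrightarrow> e \<otimes> r = r \<otimes> e"
    and fcent: "\<And>r. r \<in> carrier R \<Longrightarrow> f \<otimes> r = r \<otimes> f"
begin

lemma peirce_split:
  assumes "x \<in> carrier R"
  shows "x = x \<otimes> e \<oplus> x \<otimes> f"
  using assms e f sum by (metis idempotent_elem_def r_distr r_one)

text \<open>Centrality gives \<open>(x e)^k = x^k e\<close> and \<open>(x f)^k = x^k f\<close> for
  positive \<open>k\<close>, so \<open>x^k\<close> is the sum of the powers of its
  components.\<close>

lemma nilpotent_if_components:
  assumes x: "x \<in> carrier R" and "nilpotent_elem R (x \<otimes> e)" "nilpotent_elem R (x \<otimes> f)"
  shows "nilpotent_elem R x"
proof -
  have ec: "e \<in> carrier R" "f \<in> carrier R"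
    using e f by (auto simp: idempotent_elem_def)
  obtain m n :: nat where mn: "m > 0" "(x \<otimes> e) [^] m = \<zero>" "(x \<otimes> f) [^] n = \<zero>"
    using assms by (auto simp: nilpotent_elem_def)
  \<comment> \<open>One exponent kills both components; it is positive because \<open>m\<close> is,
    as \<open>e^k = e\<close> requires.\<close>
  define k where "k = m + n"
  have k: "k > 0" "(x \<otimes> e) [^] k = \<zero>" "(x \<otimes> f) [^] k = \<zero>"
    using mn x ec nilpotent_pow_zero_mono[of "x \<otimes> e" m k] nilpotent_pow_zero_mono[of "x \<otimes> f" n k]
    by (auto simp: k_def)
  have "x [^] k = x [^] k \<otimes> e \<oplus> x [^] k \<otimes> f"
    using x by (intro peirce_split) simp
  also have "\<dots> = (x \<otimes> e) [^] k \<oplus> (x \<otimes> f) [^] k"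
    using x ec ecent[OF x] fcent[OF x] pow_mult_distrib[of x e k] pow_mult_distrib[of x f k]
      idempotent_pow[OF e k(1)] idempotent_pow[OF f k(1)] by simp
  finally show ?thesis
    using k x unfolding nilpotent_elem_def by auto
qed

text \<open>Idempotent parts of \<open>a e\<close> and \<open>a f\<close> are cut down to their
  components and added. Conversely, an idempotent part of \<open>a\<close> cuts down to one of
  \<open>a e\<close> and one of \<open>a f\<close>, so both its components are determined.\<close>

lemma uniquely_nil_clean_if_components:
  assumes a: "a \<in> carrier R"
    and ue: "uniquely_nil_clean R (a \<otimes> e)" and uf: "uniquely_nil_clean R (a \<otimes> f)"
  shows "uniquely_nil_clean R a"
proof -
  have ec: "e \<in> carrier R" "f \<in> carrier R" "e \<otimes> e = e" "f \<otimes> f = f"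
    using e f by (auto simp: idempotent_elem_def)
  \<comment> \<open>Orthogonality comes from multiplying \<open>e + f = 1\<close> by
    \<open>e\<close>.\<close>
  have "e = e \<oplus> e \<otimes> f"
    using peirce_split[OF ec(1)] ec by simp
  then have ef: "e \<otimes> f = \<zero>"
    using add.l_cancel_one'[of e "e \<otimes> f"] ec by simp
  then have fe: "f \<otimes> e = \<zero>"
    using ecent[OF ec(2)] by simp
  have diff_mult: "(x \<ominus> y) \<otimes> z = x \<otimes> z \<ominus> y \<otimes> z"
    if "x \<in> carrier R" "y \<in> carrier R" "z \<in> carrier R" for x y z
    using that by algebra
  obtain g h where g: "idempotent_elem R g" "nilpotent_elem R (a \<otimes> e \<ominus> g)"
    and h: "idempotent_elem R h" "nilpotent_elem R (a \<otimes> f \<ominus> h)"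
    using ue uf unfolding uniquely_nil_clean_def by blast
  have gh: "g \<in> carrier R" "h \<in> carrier R"
    using g h by (auto simp: idempotent_elem_def)
  \<comment> \<open>Nothing yet places \<open>g\<close> in the component of \<open>e\<close> or
    \<open>h\<close> in that of \<open>f\<close>, so both are cut before being added.\<close>
  define p where "p = g \<otimes> e \<oplus> h \<otimes> f"
  have pc: "p \<in> carrier R"
    using gh ec by (simp add: p_def)
  have pe: "p \<otimes> e = g \<otimes> e" and pf: "p \<otimes> f = h \<otimes> f"
    using gh ec ef fe by (simp_all add: p_def l_distr m_assoc)
  have idge: "idempotent_elem R (g \<otimes> e)" and idhf: "idempotent_elem R (h \<otimes> f)"
    using idempotent_mult_central_idempotent g h e f ecent fcent by blast+
  have "p \<otimes> p = p \<otimes> (p \<otimes> e) \<oplus> p \<otimes> (p \<otimes> f)"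
    using peirce_split[of "p \<otimes> p"] pc ec by (simp add: m_assoc)
  also have "p \<otimes> (p \<otimes> e) = (p \<otimes> e) \<otimes> (p \<otimes> e)"
    using pc ec ecent[of "p \<otimes> e"] by (simp add: m_assoc)
  also have "p \<otimes> (p \<otimes> f) = (p \<otimes> f) \<otimes> (p \<otimes> f)"
    using pc ec fcent[of "p \<otimes> f"] by (simp add: m_assoc)
  finally have "p \<otimes> p = p"
    unfolding pe pf using idge idhf by (simp add: idempotent_elem_def p_def)
  then have idp: "idempotent_elem R p"
    using pc by (simp add: idempotent_elem_def)
  \<comment> \<open>Both components of \<open>a - p\<close> are nilpotent elements cut by a central
    idempotent, hence nilpotent.\<close>
  have "(a \<ominus> p) \<otimes> e = (a \<otimes> e \<ominus> g) \<otimes> e" "(a \<ominus> p) \<otimes> f = (a \<otimes> f \<ominus> h) \<otimes> f"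
    using a pc gh ec by (simp_all add: diff_mult pe pf m_assoc)
  then have "nilpotent_elem R (a \<ominus> p)"
    using nilpotent_mult_central_idempotent[OF g(2) e ecent]
      nilpotent_mult_central_idempotent[OF h(2) f fcent] nilpotent_if_components[of "a \<ominus> p"] a pc
    by simp
  moreover have "q = q'"
    if q: "idempotent_elem R q" "nilpotent_elem R (a \<ominus> q)"
      and q': "idempotent_elem R q'" "nilpotent_elem R (a \<ominus> q')" for q q'
  proof -
    have qc: "q \<in> carrier R" "q' \<in> carrier R"
      using q q' by (auto simp: idempotent_elem_def)
    \<comment> \<open>Stated for a general central idempotent \<open>z\<close> so that it applies to
      \<open>e\<close> and \<open>f\<close> alike.\<close>
    have eq: "q \<otimes> z = q' \<otimes> z"
      if z: "idempotent_elem R z" "\<And>r. r \<in> carrier R \<Longrightarrow> z \<otimes> r = r \<otimes> z"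
        and u: "uniquely_nil_clean R (a \<otimes> z)" for z
    proof -
      have "z \<in> carrier R"
        using z by (auto simp: idempotent_elem_def)
      then show ?thesis
        using uniquely_nil_clean_unique[OF u, of "q \<otimes> z" "q' \<otimes> z"] a qc
          nilpotent_mult_central_idempotent[OF q(2) z] nilpotent_mult_central_idempotent[OF q'(2) z]
          idempotent_mult_central_idempotent[OF q(1) z] idempotent_mult_central_idempotent[OF q'(1) z]
        by (simp add: diff_mult)
    qed
    show ?thesis
      using eq[OF e ecent ue] eq[OF f fcent uf] peirce_split qc by metis
  qed
  ultimately show ?thesis
    unfolding uniquely_nil_clean_def using a idp by blast
qed

end

section \<open>GUNC rings by their idempotents\<close>

lemma UNC_if_nontrivial_idempotent:
  assumes gunc: "GUNC_ring R" and e: "idempotent_elem R e" "e \<noteq> \<zero>" "e \<noteq> \<one>"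
  shows "UNC_ring R"
proof -
  have unc: "uniquely_nil_clean R a" if "a \<in> carrier R" "a \<notin> Units R" for a
    using gunc that by (simp add: GUNC_ring_def)
  define f where "f = \<one> \<ominus> e"
  have c: "e \<in> carrier R" "e \<otimes> e = e" "f \<in> carrier R"
    using e(1) by (auto simp: idempotent_elem_def f_def)
  have "f \<otimes> f = f"
    unfolding f_def using c(1,2)
    by (simp add: minus_eq l_distr r_distr l_minus r_minus a_assoc l_neg r_neg)
  then have idf: "idempotent_elem R f"
    using c by (simp add: idempotent_elem_def)
  have sum: "e \<oplus> f = \<one>"
    unfolding f_def using c(1) by algebra
  have f: "f \<noteq> \<zero>" "f \<noteq> \<one>"
    using sum e c by (auto simp: f_def)
  have ef: "e \<otimes> f = \<zero>" "f \<otimes> e = \<zero>"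
    unfolding f_def using c(1,2) by (simp_all add: minus_eq l_distr r_distr l_minus r_minus r_neg)
  have nonunit: "e \<notin> Units R" "f \<notin> Units R"
    using idempotent_Units_eq_one e idf f by blast+
  have ecent: "e \<otimes> r = r \<otimes> e" and fcent: "f \<otimes> r = r \<otimes> f" if "r \<in> carrier R" for r
    using uniquely_nil_clean_idempotent_central unc e idf nonunit c that by auto
  have nu: "a \<otimes> e \<notin> Units R" "a \<otimes> f \<notin> Units R" if a: "a \<in> carrier R" for a
  proof -
    \<comment> \<open>A unit \<open>a e\<close> could be cancelled here, forcing
      \<open>f = 0\<close>; likewise a unit \<open>a f\<close> would force
      \<open>e = 0\<close>.\<close>
    have "a \<otimes> e \<otimes> f = \<zero>" "a \<otimes> f \<otimes> e = \<zero>"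
      using a c ef by (simp_all add: m_assoc)
    then show "a \<otimes> e \<notin> Units R" "a \<otimes> f \<notin> Units R"
      using e f c by (metis Units_closed Units_l_cancel r_null zero_closed)+
  qed
  have "uniquely_nil_clean R a" if a: "a \<in> carrier R" for a
    using uniquely_nil_clean_if_components[OF e(1) idf sum ecent fcent a] unc nu[OF a] a c by simp
  then show ?thesis
    unfolding UNC_ring_def using ring_axioms by blast
qed

text \<open>The idempotent part of \<open>a\<close> cannot be one, since \<open>a - 1\<close>
  nilpotent makes \<open>a\<close> a unit; so it is zero.\<close>

lemma nonunit_nilpotent_if_trivial_idempotents:
  assumes gunc: "GUNC_ring R" and triv: "\<And>e. idempotent_elem R e \<Longrightarrow> e = \<zero> \<or> e = \<one>"
    and a: "a \<in> carrier R - Units R"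
  shows "nilpotent_elem R a"
proof -
  obtain e where "idempotent_elem R e" "nilpotent_elem R (a \<ominus> e)"
    using gunc a unfolding GUNC_ring_def uniquely_nil_clean_def by blast
  with triv[of e] a Units_if_minus_one_nilpotent show ?thesis
    by (auto simp: minus_eq)
qed

text \<open>The zero ring has no nontrivial idempotent, yet it is not local because its quotient by
  the radical has one equal to zero. It therefore has to be settled on the UNC side.\<close>

lemma UNC_if_one_eq_zero:
  assumes "\<one> = \<zero>"
  shows "UNC_ring R"
proof -
  have carr: "a = \<zero>" if "a \<in> carrier R" for a
    using one_zeroD[OF assms] that by simp
  have "uniquely_nil_clean R \<zero>"
    unfolding uniquely_nil_clean_def
  proof (intro conjI ex1I[of _ \<zero>])
    show "idempotent_elem R \<zero>" "nilpotent_elem R (\<zero> \<ominus> \<zero>)"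
      using nilpotent_elem_zero by (simp_all add: idempotent_elem_def minus_eq)
  qed (use carr in \<open>simp_all add: idempotent_elem_def\<close>)
  then show ?thesis
    unfolding UNC_ring_def using ring_axioms carr by blast
qed

end

theorem lemma2p10:
  fixes R :: "('a, 'b) ring_scheme"
  assumes "ring R"
  shows "(local_ring R \<and> nil_subset R (jacobson_radical R)) \<or> UNC_ring R \<longleftrightarrow> GUNC_ring R"
proof -
  interpret ring R by fact
  have "(local_ring R \<and> nil_subset R (jacobson_radical R)) \<or> UNC_ring R" if "GUNC_ring R"
    \<comment> \<open>Three cases: a nontrivial idempotent or the zero ring gives UNC; otherwise all
      nonunits are nilpotent and the ring is local.\<close>
    using UNC_if_nontrivial_idempotent[OF that] UNC_if_one_eq_zero local_if_nonunits_nilpotent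
      nonunit_nilpotent_if_trivial_idempotents[OF that] by blast
  moreover have "GUNC_ring R" if "UNC_ring R"
    using that by (simp add: UNC_ring_def GUNC_ring_def)
  ultimately show ?thesis
    using local_nil_radical_imp_GUNC by blast
qed

end
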